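(* Let $\mathbb K$ be a field of characteristic zero or at least $5$. Let $T=\sum_{i=1}^r a_{i1}\wedge a_{i2}\wedge a_{i3}\in\Lambda^3(\mathbb K^n)$ be an alternating tensor, where all terms $a_{i1}\wedge a_{i2}\wedge a_{i3}$ are nonzero, and let $U_i=\langle a_{i1},a_{i2},a_{i3}\rangle\subseteq\mathbb K^n$. Suppose that the collection of subspaces $U_1,\dots,U_r$ has Kruskal rank $k$, and that $2r\le 3k-2$. Then $T$ has skew rank $r$, and this is the unique skew rank decomposition of $T$.
   Context: For a multiset $\{U_1,\dots,U_r\}$ of $r\ge1$ nonzero subspaces of $\mathbb K^n$, the Kruskal rank is the largest $\ell$ such that every sub-multiset of cardinality $\ell$ is in direct sum, i.e. $\dim(U_{i_1}+\dots+U_{i_\ell})=\dim U_{i_1}+\dots+\dim U_{i_\ell}$ for all pairwise distinct $i_1,\dots,i_\ell\in\{1,\dots,r\}$. Alternating tensors are viewed inside $(\mathbb K^n)^{\otimes 3}$ via $x_1\wedge x_2\wedge x_3=\frac1{3!}\sum_{\sigma\in\mathfrak S_3}\operatorname{sgn}(\sigma)\,x_{\sigma(1)}\otimes x_{\sigma(2)}\otimes x_{\sigma(3)}$. The skew rank of $T\in\Lambda^3(\mathbb K^n)$ is the smallest number of terms in an expression of $T$ as a sum of wedge products $a\wedge b\wedge c$ with $a,b,c\in\mathbb K^n$; an expression with that minimal number of terms is a skew rank decomposition. Uniqueness means that any two skew rank decompositions of $T$ have the same terms $a\wedge b\wedge c$ (as elements of $\Lambda^3(\mathbb K^n)$) up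 to reordering. *)

theory Defs
  imports "HOL-Analysis.Analysis" "HOL-Combinatorics.Permutations"
begin

text \<open>
  The space \<open>K\<^sup>n\<close> is \<open>'a ^ 'n\<close> with \<open>'a\<close> a field and \<open>n = CARD('n)\<close>. A tensor in its third
  tensor power is identified with its array of coordinates with respect to the standard basis.
\<close>

definition tensor3 ::
    "'a::field ^ 'n \<Rightarrow> 'a ^ 'n \<Rightarrow> 'a ^ 'n \<Rightarrow> 'a ^ 'n ^ 'n ^ 'n" where
  "tensor3 x y z = (\<chi> i j k. x $ i * y $ j * z $ k)"

text \<open>
  The three vectors are passed as a family \<open>x 1, x 2, x 3\<close>. The coefficient is written
  \<open>of_nat (fact 3)\<close> because the polymorphic \<open>fact\<close> is restricted to characteristic zero.
\<close>

definition wedge3 :: "(nat \<Rightarrow> 'a::field ^ 'n) \<Rightarrow> 'a ^ 'n ^ 'n ^ 'n" where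
  "wedge3 x = (\<chi> i j k. 1 / of_nat (fact 3) *
     (\<Sum>\<sigma> | \<sigma> permutes {1..3::nat}.
        of_int (sign \<sigma>) * tensor3 (x (\<sigma> 1)) (x (\<sigma> 2)) (x (\<sigma> 3)) $ i $ j $ k))"

text \<open>Only the values \<open>a i j\<close> with \<open>1 \<le> i \<le> r\<close> and \<open>1 \<le> j \<le> 3\<close> are relevant below.\<close>

definition skew_expression ::
    "'a::field ^ 'n ^ 'n ^ 'n \<Rightarrow> nat \<Rightarrow> (nat \<Rightarrow> nat \<Rightarrow> 'a ^ 'n) \<Rightarrow> bool" where
  "skew_expression T r a \<longleftrightarrow> T = (\<Sum>i = 1..r. wedge3 (a i))"

text \<open>Meaningful only for alternating \<open>T\<close>, that is, for sums of wedge products.\<close>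

definition skew_rank :: "'a::field ^ 'n ^ 'n ^ 'n \<Rightarrow> nat" where
  "skew_rank T = (LEAST r. \<exists>a. skew_expression T r a)"

definition skew_rank_decomposition ::
    "'a::field ^ 'n ^ 'n ^ 'n \<Rightarrow> nat \<Rightarrow> (nat \<Rightarrow> nat \<Rightarrow> 'a ^ 'n) \<Rightarrow> bool" where
  "skew_rank_decomposition T r a \<longleftrightarrow> skew_expression T r a \<and> r = skew_rank T"

definition unique_skew_rank_decomposition :: "'a::field ^ 'n ^ 'n ^ 'n \<Rightarrow> bool" where
  "unique_skew_rank_decomposition T \<longleftrightarrow>
     (\<forall>r a s b. skew_rank_decomposition T r a \<longrightarrow> skew_rank_decomposition T s b \<longrightarrow>
        image_mset (\<lambda>i. wedge3 (a i)) (mset_set {1..r}) =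
        image_mset (\<lambda>i. wedge3 (b i)) (mset_set {1..s}))"

text \<open>
  Here \<open>\<Sum>i\<in>J. U i\<close> is the elementwise (Minkowski) sum, which for subspaces is their sum. The
  condition \<open>l \<le> r\<close> rules out values of \<open>l\<close> for which there is no sub-multiset of size \<open>l\<close>.
\<close>

definition kruskal_rank :: "nat \<Rightarrow> (nat \<Rightarrow> ('a::field ^ 'n) set) \<Rightarrow> nat" where
  "kruskal_rank r U = Max {l. l \<le> r \<and>
     (\<forall>J. J \<subseteq> {1..r} \<and> card J = l \<longrightarrow> vec.dim (\<Sum>i\<in>J. U i) = (\<Sum>i\<in>J. vec.dim (U i)))}"

end

theory Submission
  imports Defs "HOL-Computational_Algebra.Polynomial_Factorial"
begin

text \<open>
  Suppose \<open>T = \<Sum>i\<le>r. a\<^sub>i = \<Sum>j\<le>r. b\<^sub>j\<close> for wedge products \<open>a\<^sub>i\<close> with spans \<open>U\<^sub>i\<close> and \<open>b\<^sub>j\<close> with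
  spans \<open>V\<^sub>j\<close>, a shorter second expression being padded with zeros. Contraction with a functional
  \<open>f\<close> makes each term an alternating form of rank at most 2, nonzero on the left exactly when \<open>f\<close>
  is nonzero on \<open>U\<^sub>i\<close>. Comparing ranks shows that if \<open>f\<close> vanishes on at least \<open>k - 1\<close> of the
  \<open>V\<^sub>j\<close>, then it vanishes on at least as many of the \<open>U\<^sub>i\<close>. With a generic \<open>f\<close> over \<open>K(t)\<close>
  this gives: a subspace that contains at least \<open>k - 1\<close> of the \<open>V\<^sub>j\<close> contains at least as many of
  the \<open>U\<^sub>i\<close>. By dimension, any \<open>k\<close> of the \<open>V\<^sub>j\<close> are therefore independent. A count as in
  Kruskal's permutation lemma then shows, by descending induction on \<open>m\<close>, that the sum of any \<open>m\<close> of
  the \<open>V\<^sub>j\<close> contains at least \<open>m\<close> of the \<open>U\<^sub>i\<close>. For \<open>m = 1\<close> the spaces \<open>V\<^sub>j\<close> and \<open>U\<^sub>i\<close> agree up to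
  order, so corresponding terms are proportional, and the rank comparison once more shows that they
  are equal.
\<close>

section \<open>Functionals, acting through the scalar product, and dual families\<close>

notation scalar_product (infixl "\<odot>" 70)

lemma scalar_product_linear [simp]:
  fixes x y z :: "'a::field ^ 'n"
  shows "x \<odot> (y + z) = x \<odot> y + x \<odot> z" "(y + z) \<odot> x = y \<odot> x + z \<odot> x"
    and "x \<odot> (y - z) = x \<odot> y - x \<odot> z" "(y - z) \<odot> x = y \<odot> x - z \<odot> x"
    and "x \<odot> (c *s y) = c * (x \<odot> y)" "(c *s y) \<odot> x = c * (y \<odot> x)"
    and "x \<odot> 0 = 0" "0 \<odot> x = 0"
  by (simp_all add: scalar_product_def algebra_simps sum.distrib sum_subtractf sum_distrib_left)

lemma scalar_product_sum:
  fixes d :: "'a::field ^ 'n"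
  shows "d \<odot> (\<Sum>i\<in>A. x i) = (\<Sum>i\<in>A. d \<odot> x i)"
  by (induction A rule: infinite_finite_induct) auto

lemma subspace_annihilated: "vec.subspace {x. d \<odot> x = 0}"
  by (auto simp: vec.subspace_def)

lemma scalar_product_span_eq_0:
  assumes "\<And>x. x \<in> S \<Longrightarrow> d \<odot> x = 0" "y \<in> vec.span S"
  shows "d \<odot> y = 0"
  using vec.span_minimal[OF _ subspace_annihilated, of S d] assms by auto

text \<open>
  Independence of a family is recorded by a dual family, because this witness is inherited by
  extension fields.
\<close>

definition biorthogonal :: "'i set \<Rightarrow> ('i \<Rightarrow> 'a::field ^ 'n) \<Rightarrow> ('i \<Rightarrow> 'a ^ 'n) \<Rightarrow> bool" where
  "biorthogonal A d x \<longleftrightarrow> (\<forall>s\<in>A. \<forall>t\<in>A. d s \<odot> x t = (if s = t then 1 else 0))"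

lemma biorthogonal_subset: "biorthogonal A d x \<Longrightarrow> B \<subseteq> A \<Longrightarrow> biorthogonal B d x"
  unfolding biorthogonal_def by blast

lemma biorthogonal_card_le:
  assumes bi: "biorthogonal A d x" and A: "finite A"
    and S: "finite S" "\<And>s. s \<in> A \<Longrightarrow> x s \<in> vec.span S"
  shows "card A \<le> card S"
proof -
  have d: "d s \<odot> x t = (if s = t then 1 else 0)" if "s \<in> A" "t \<in> A" for s t
    using bi that by (simp add: biorthogonal_def)
  have inj: "inj_on x A"
    by (intro inj_onI) (metis d zero_neq_one)
  have "vec.independent (x ` A)"
  proof (rule vec.independent_if_scalars_zero)
    fix c v assume 0: "(\<Sum>w\<in>x ` A. c w *s w) = 0" and "v \<in> x ` A"
    then obtain s where s: "s \<in> A" "v = x s" by blast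
    have "0 = d s \<odot> (\<Sum>t\<in>A. c (x t) *s x t)"
      using 0 by (simp add: sum.reindex[OF inj])
    also have "\<dots> = (\<Sum>t\<in>A. if s = t then c (x t) else 0)"
      unfolding scalar_product_sum by (rule sum.cong) (auto simp: d s)
    also have "\<dots> = c v" using A s by (simp add: sum.delta')
    finally show "c v = 0" by simp
  qed (use A in simp)
  then have "card (x ` A) \<le> card S"
    using vec.independent_span_bound[OF S(1)] S(2) by blast
  then show ?thesis by (simp add: card_image[OF inj])
qed

lemma biorthogonal_exists:
  fixes x :: "'i \<Rightarrow> 'a::field ^ 'n"
  assumes A: "finite A" and dim: "card A \<le> vec.dim (x ` A)"
  obtains d where "biorthogonal A d x"
proof -
  have *: "vec.dim (x ` A) \<le> card (x ` A)" "card (x ` A) \<le> card A"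
    using A vec.dim_le_card[of "x ` A" "x ` A"] by (auto simp: vec.span_superset card_image_le)
  then have inj: "inj_on x A" using dim A by (intro eq_card_imp_inj_on) auto
  have ind: "vec.independent (x ` A)"
    using vec.card_le_dim_spanning[of "x ` A" "x ` A"] * dim A vec.span_superset[of "x ` A"] by auto
  have "\<exists>d. \<forall>t\<in>A. d \<odot> x t = (if s = t then 1 else 0)" for s
  proof -
    obtain g :: "'a ^ 'n \<Rightarrow> 'a ^ 'n" where g: "Vector_Spaces.linear (*s) (*s) g"
      "\<And>v. v \<in> x ` A \<Longrightarrow> g v = (if s = inv_into A x v then 1 else 0)"
      using vec.linear_independent_extend[OF ind, of "\<lambda>v. if s = inv_into A x v then 1 else 0"] by blast
    \<comment> \<open>The values 0 and 1 of \<open>g\<close> are constant vectors, so any single row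
      of its matrix serves as the functional.\<close>
    fix i0 :: 'n
    have "(matrix g $ i0) \<odot> v = g v $ i0" for v
      unfolding matrix_works[OF g(1), of v, symmetric]
      by (simp add: matrix_vector_mult_def scalar_product_def)
    then have "\<forall>t\<in>A. (matrix g $ i0) \<odot> x t = (if s = t then 1 else 0)"
      using g(2) inj by auto
    then show ?thesis by blast
  qed
  then obtain d where "\<And>s. \<forall>t\<in>A. d s \<odot> x t = (if s = t then 1 else 0)" by metis
  then show thesis by (intro that[of d]) (simp add: biorthogonal_def)
qed

section \<open>Wedge products in coordinates and their contractions\<close>

text \<open>The 3 by 3 minor on the coordinates \<open>i\<close>, \<open>j\<close>,
  \<open>k\<close>: the wedge product without its factor 1/6. As an integer polynomial in the
  entries it passes unchanged to extension fields.\<close>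

definition alt3 :: "(nat \<Rightarrow> 'a::field ^ 'n) \<Rightarrow> 'n \<Rightarrow> 'n \<Rightarrow> 'n \<Rightarrow> 'a" where
  "alt3 x i j k =
     x 1 $ i * (x 2 $ j * x 3 $ k - x 3 $ j * x 2 $ k)
   + x 2 $ i * (x 3 $ j * x 1 $ k - x 1 $ j * x 3 $ k)
   + x 3 $ i * (x 1 $ j * x 2 $ k - x 2 $ j * x 1 $ k)"

lemma wedge3_nth: "wedge3 x $ i $ j $ k = alt3 x i j k / 6"
proof -
  have eq: "{1..3} = {1, 2, 3::nat}" by auto
  have f: "finite {2, 3::nat}" "1 \<notin> {2, 3::nat}" "finite {3::nat}" "2 \<notin> {3::nat}" by auto
  show ?thesis
    unfolding wedge3_def eq sum_over_permutations_insert[OF f(1,2)] sum_over_permutations_insert[OF f(3,4)]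
      permutes_sing
    by (simp add: alt3_def tensor3_def sign_swap_id sign_compose permutation_swap_id permutation_compose
        fact_numeral algebra_simps Transposition.transpose_def)
qed

text \<open>The tensor \<open>alt3 a\<close> with \<open>f\<close> inserted in the first slot and
  \<open>x\<close> in the last. For fixed \<open>f\<close> this is an alternating form read as a
  linear map in \<open>x\<close>, so its rank is the dimension of its image.\<close>

definition contract :: "(nat \<Rightarrow> 'a::field ^ 'n) \<Rightarrow> 'a ^ 'n \<Rightarrow> 'a ^ 'n \<Rightarrow> 'a ^ 'n" where
  "contract a f x =
     ((f \<odot> a 3) * (x \<odot> a 2) - (f \<odot> a 2) * (x \<odot> a 3)) *s a 1
   + ((f \<odot> a 1) * (x \<odot> a 3) - (f \<odot> a 3) * (x \<odot> a 1)) *s a 2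
   + ((f \<odot> a 2) * (x \<odot> a 1) - (f \<odot> a 1) * (x \<odot> a 2)) *s a 3"

lemma contract_nth: "contract a f x $ j = (\<Sum>i\<in>UNIV. \<Sum>k\<in>UNIV. f $ i * x $ k * alt3 a i j k)"
proof -
  have *: "(\<Sum>i\<in>UNIV. \<Sum>k\<in>UNIV. f $ i * x $ k * (u $ i * c * v $ k)) = (f \<odot> u) * (x \<odot> v) * c" for u v c
    unfolding scalar_product_def sum_product
    unfolding sum_distrib_right
    by (intro sum.cong refl) (simp add: algebra_simps)
  have "(\<Sum>i\<in>UNIV. \<Sum>k\<in>UNIV. f $ i * x $ k * alt3 a i j k) =
     (\<Sum>i\<in>UNIV. \<Sum>k\<in>UNIV. f $ i * x $ k * (a 1 $ i * a 2 $ j * a 3 $ k))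
   - (\<Sum>i\<in>UNIV. \<Sum>k\<in>UNIV. f $ i * x $ k * (a 1 $ i * a 3 $ j * a 2 $ k))
   + (\<Sum>i\<in>UNIV. \<Sum>k\<in>UNIV. f $ i * x $ k * (a 2 $ i * a 3 $ j * a 1 $ k))
   - (\<Sum>i\<in>UNIV. \<Sum>k\<in>UNIV. f $ i * x $ k * (a 2 $ i * a 1 $ j * a 3 $ k))
   + (\<Sum>i\<in>UNIV. \<Sum>k\<in>UNIV. f $ i * x $ k * (a 3 $ i * a 1 $ j * a 2 $ k))
   - (\<Sum>i\<in>UNIV. \<Sum>k\<in>UNIV. f $ i * x $ k * (a 3 $ i * a 2 $ j * a 1 $ k))"
    unfolding sum_subtractf[symmetric] sum.distrib[symmetric]
    by (intro sum.cong refl) (simp add: alt3_def algebra_simps)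
  then show ?thesis
    unfolding * by (simp add: contract_def algebra_simps)
qed

lemma contract_eq_0:
  assumes "\<And>l. l \<in> {1..3} \<Longrightarrow> f \<odot> a l = 0"
  shows "contract a f x = 0"
  using assms by (simp add: contract_def)

lemma contract_dual_eq_0:
  assumes "\<And>l. l \<in> {1..3} \<Longrightarrow> x \<odot> a l = 0"
  shows "contract a f x = 0"
  using assms by (simp add: contract_def)

text \<open>If \<open>f\<close> is nonzero on \<open>a l\<close>, subtracting multiples of
  \<open>a l\<close> makes \<open>f\<close> vanish on the other two vectors without changing the
  wedge product; the contraction is then a multiple of their wedge.\<close>

lemma contract_eq_wedge2:
  fixes a :: "nat \<Rightarrow> 'a::field ^ 'n"
  assumes "\<exists>l\<in>{1..3}. f \<odot> a l \<noteq> 0"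
  obtains l m n \<alpha> \<beta> where "distinct [l, m, n]" "{l, m, n} = {1..3}" "f \<odot> a l \<noteq> 0"
    "\<And>x. contract a f x = (f \<odot> a l) *s
       ((x \<odot> (a n - \<beta> *s a l)) *s (a m - \<alpha> *s a l) - (x \<odot> (a m - \<alpha> *s a l)) *s (a n - \<beta> *s a l))"
proof -
  have eq3: "{1..3} = {1, 2, 3::nat}" by auto
  from assms consider "f \<odot> a 1 \<noteq> 0" | "f \<odot> a 2 \<noteq> 0" | "f \<odot> a 3 \<noteq> 0" unfolding eq3 by blast
  then show thesis
  proof cases
    case 1
    \<comment> \<open>\<open>\<beta>\<close> is instantiated before \<open>\<alpha>\<close>, as it
      occurs first in the claim. Both are the ratios that make \<open>f\<close> vanish:
      \<open>\<alpha>\<close> belongs to \<open>a m\<close> and \<open>\<beta>\<close> to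
      \<open>a n\<close>.\<close>
    show ?thesis
      by (rule that[of 1 2 3 "(f \<odot> a 3) / (f \<odot> a 1)" "(f \<odot> a 2) / (f \<odot> a 1)"])
        (use 1 in \<open>auto simp: eq3 contract_def vec_eq_iff field_simps\<close>)
  next
    case 2
    show ?thesis
      by (rule that[of 2 3 1 "(f \<odot> a 1) / (f \<odot> a 2)" "(f \<odot> a 3) / (f \<odot> a 2)"])
        (use 2 in \<open>auto simp: eq3 contract_def vec_eq_iff field_simps\<close>)
  next
    case 3
    show ?thesis
      by (rule that[of 3 1 2 "(f \<odot> a 2) / (f \<odot> a 3)" "(f \<odot> a 1) / (f \<odot> a 3)"])
        (use 3 in \<open>auto simp: eq3 contract_def vec_eq_iff field_simps\<close>)
  qed
qed

section \<open>Rank comparison of contracted sums\<close>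

definition touching :: "('i \<Rightarrow> nat \<Rightarrow> 'a::field ^ 'n) \<Rightarrow> 'a ^ 'n \<Rightarrow> 'i set \<Rightarrow> 'i set" where
  "touching a f A = {i \<in> A. \<exists>l\<in>{1..3}. f \<odot> a i l \<noteq> 0}"

lemma contract_in_span_pair:
  obtains p q where "\<And>x. contract a f x \<in> vec.span {p, q}"
proof (cases "\<exists>l\<in>{1..3}. f \<odot> a l \<noteq> 0")
  case True
  then obtain l m n \<alpha> \<beta> where con: "\<And>x. contract a f x = (f \<odot> a l) *s
       ((x \<odot> (a n - \<beta> *s a l)) *s (a m - \<alpha> *s a l) - (x \<odot> (a m - \<alpha> *s a l)) *s (a n - \<beta> *s a l))"
    by (rule contract_eq_wedge2) blast
  show ?thesis
    by (rule that[of "a m - \<alpha> *s a l" "a n - \<beta> *s a l"], unfold con,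
        intro vec.span_diff vec.span_scale vec.span_base) auto
next
  case False
  then show ?thesis
    using contract_eq_0[of f a] by (intro that[of 0 0]) (metis vec.span_zero)
qed

lemma contract_untouched:
  assumes "i \<in> A - touching a f A"
  shows "contract (a i) f x = 0"
  using assms by (intro contract_eq_0) (auto simp: touching_def)

lemma span_scaleD:
  assumes "c *s x \<in> vec.span S" "c \<noteq> 0"
  shows "x \<in> vec.span S"
  using vec.span_scale[OF assms(1), of "inverse c"] assms(2) by simp

lemma card_le_2: "card {p, q} \<le> 2"
  by (simp add: card_insert_if)

text \<open>At most \<open>k\<close> touched terms \<open>I0\<close> on the left have independent
  contractions, of total rank \<open>2 * card I0\<close>; every other touched term on either side
  has rank at most 2. Hence twice \<open>card I0\<close> is at most the number of touched terms on
  both sides. If \<open>I0\<close> exhausts the left side, this is the claim; otherwise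
  \<open>card I0 = k\<close>, contrary to \<open>small\<close>. The weights \<open>c\<close> serve
  the final comparison of proportional terms.\<close>

lemma card_touching_le:
  fixes a :: "'i \<Rightarrow> nat \<Rightarrow> 'a::field ^ 'n" and b :: "'j \<Rightarrow> nat \<Rightarrow> 'a ^ 'n"
  assumes fin: "finite A" "finite B"
    and eq: "\<And>x. (\<Sum>i\<in>A. c i *s contract (a i) f x) = (\<Sum>j\<in>B. contract (b j) f x)"
    and c: "\<And>i. i \<in> A \<Longrightarrow> c i \<noteq> 0"
    and dual: "\<And>J. J \<subseteq> A \<Longrightarrow> card J \<le> k \<Longrightarrow> \<exists>d. biorthogonal (J \<times> {1..3}) d (\<lambda>(i, l). a i l)"
    and small: "card (touching b f B) + card A < 2 * k"
  shows "card (touching a f A) \<le> card (touching b f B)"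
proof -
  let ?I = "touching a f A" and ?I' = "touching b f B"
  have finI: "finite ?I" "finite ?I'" and IA: "?I \<subseteq> A" "?I' \<subseteq> B"
    using fin by (auto simp: touching_def)
  obtain I0 where I0: "I0 \<subseteq> ?I" "card I0 = min k (card ?I)"
    by (metis min.cobounded2 obtain_subset_with_card_n)
  have I0A: "I0 \<subseteq> A" and finI0: "finite I0" using I0 IA finI finite_subset by blast+
  obtain d where d: "biorthogonal (I0 \<times> {1..3}) d (\<lambda>(i, l). a i l)"
    using dual[OF I0A] I0 by auto
  have d: "d (i, l) \<odot> a i' l' = (if i = i' \<and> l = l' then 1 else 0)"
    if "i \<in> I0" "i' \<in> I0" "l \<in> {1..3}" "l' \<in> {1..3}" for i i' l l'
    using d that unfolding biorthogonal_def by fastforce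
  have "\<exists>S. finite S \<and> card S \<le> 2 \<and> (\<forall>x. contract (a i) f x \<in> vec.span S)" for i
    by (rule contract_in_span_pair[of "a i" f]) (metis card_le_2 finite.emptyI finite.insertI)
  then obtain S where S: "\<And>i. finite (S i)" "\<And>i. card (S i) \<le> 2" "\<And>i x. contract (a i) f x \<in> vec.span (S i)"
    by metis
  have "\<exists>S. finite S \<and> card S \<le> 2 \<and> (\<forall>x. contract (b i) f x \<in> vec.span S)" for i
    by (rule contract_in_span_pair[of "b i" f]) (metis card_le_2 finite.emptyI finite.insertI)
  then obtain S' where S': "\<And>i. finite (S' i)" "\<And>i. card (S' i) \<le> 2" "\<And>i x. contract (b i) f x \<in> vec.span (S' i)"
    by metis
  \<comment> \<open>At most two generators for each touched term outside \<open>I0\<close>.\<close>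
  define Z where "Z = (\<Union>i\<in>?I - I0. S i) \<union> (\<Union>j\<in>?I'. S' j)"
  have "card Z \<le> (\<Sum>i\<in>?I - I0. card (S i)) + (\<Sum>j\<in>?I'. card (S' j))"
    unfolding Z_def by (intro order_trans[OF card_Un_le] add_mono card_UN_le) (use finI in auto)
  also have "\<dots> \<le> (\<Sum>i\<in>?I - I0. 2) + (\<Sum>j\<in>?I'. 2)"
    by (intro add_mono sum_mono S S')
  also have "\<dots> = 2 * (card ?I - card I0 + card ?I')"
    using I0 finI0 by (simp add: card_Diff_subset)
  finally have cardZ: "card Z \<le> 2 * (card ?I - card I0 + card ?I')" .
  have finZ: "finite Z" using finI S S' by (auto simp: Z_def)
  have inZ: "(\<Sum>i\<in>I0. c i *s contract (a i) f x) \<in> vec.span Z" for x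
  proof -
    have "(\<Sum>i\<in>A. c i *s contract (a i) f x) = (\<Sum>i\<in>?I. c i *s contract (a i) f x)"
      by (intro sum.mono_neutral_right fin IA ballI) (metis (lifting) contract_untouched Diff_iff vec.scale_zero_right)
    also have "\<dots> = (\<Sum>i\<in>?I - I0. c i *s contract (a i) f x) + (\<Sum>i\<in>I0. c i *s contract (a i) f x)"
      by (intro sum.subset_diff I0 finI)
    finally have "(\<Sum>i\<in>I0. c i *s contract (a i) f x) =
        (\<Sum>j\<in>B. contract (b j) f x) - (\<Sum>i\<in>?I - I0. c i *s contract (a i) f x)"
      using eq[of x] by (simp add: algebra_simps)
    also have "(\<Sum>j\<in>B. contract (b j) f x) = (\<Sum>j\<in>?I'. contract (b j) f x)"
      by (intro sum.mono_neutral_right fin IA ballI) (rule contract_untouched)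
    also have "\<dots> - (\<Sum>i\<in>?I - I0. c i *s contract (a i) f x) \<in> vec.span Z"
    proof (intro vec.span_diff vec.span_sum vec.span_scale)
      fix j assume "j \<in> ?I'"
      then show "contract (b j) f x \<in> vec.span Z"
        using vec.span_mono[of "S' j" Z] S'(3)[of j x] by (auto simp: Z_def)
    next
      fix i assume "i \<in> ?I - I0"
      then show "contract (a i) f x \<in> vec.span Z"
        using vec.span_mono[of "S i" Z] S(3)[of i x] unfolding Z_def by blast
    qed
    finally show ?thesis .
  qed
  \<comment> \<open>The booleans index the two vectors whose wedge is the contraction of term
    \<open>i\<close>; \<open>P s\<close> is the slot whose dual vector picks out
    \<open>p s\<close>.\<close>
  define Q :: "'i \<Rightarrow> (bool \<Rightarrow> nat) \<Rightarrow> (bool \<Rightarrow> 'a ^ 'n) \<Rightarrow> bool" where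
    "Q i P p \<longleftrightarrow> (\<forall>s. p s \<in> vec.span Z \<and> P s \<in> {1..3} \<and> p s \<in> vec.span {a i 1, a i 2, a i 3}
      \<and> (\<forall>t. d (i, P s) \<odot> p t = (if s = t then 1 else 0)))" for i P p
  have ex: "\<exists>P p. Q i P p"
    if i: "i \<in> I0" for i
  proof -
    have "\<exists>l\<in>{1..3}. f \<odot> a i l \<noteq> 0" using i I0 by (auto simp: touching_def)
    then obtain l m n \<alpha> \<beta> where lmn: "distinct [l, m, n]" "{l, m, n} = {1..3}" and l: "f \<odot> a i l \<noteq> 0"
      and con: "\<And>x. contract (a i) f x = (f \<odot> a i l) *s
       ((x \<odot> (a i n - \<beta> *s a i l)) *s (a i m - \<alpha> *s a i l) - (x \<odot> (a i m - \<alpha> *s a i l)) *s (a i n - \<beta> *s a i l))"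
      by (rule contract_eq_wedge2) blast
    define p q where "p = a i m - \<alpha> *s a i l" and "q = a i n - \<beta> *s a i l"
    have in3: "l \<in> {1..3}" "m \<in> {1..3}" "n \<in> {1..3}" using lmn(2) by blast+
    have dp: "d (i, m) \<odot> p = 1" "d (i, n) \<odot> p = 0" "d (i, m) \<odot> q = 0" "d (i, n) \<odot> q = 1"
      using lmn(1) i in3 by (auto simp: p_def q_def d)
    \<comment> \<open>A dual vector of term \<open>i\<close> kills the other terms of
      \<open>I0\<close>. What remains is a nonzero multiple of \<open>p\<close> for slot
      \<open>n\<close> and of \<open>q\<close> for slot \<open>m\<close>, so both lie in the span of
      \<open>Z\<close>.\<close>
    have one: "(\<Sum>i'\<in>I0. c i' *s contract (a i') f (d (i, l'))) = c i *s contract (a i) f (d (i, l'))"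
      if "l' \<in> {1..3}" for l'
    proof -
      have "contract (a i') f (d (i, l')) = 0" if "i' \<in> I0 - {i}" for i'
        using that i \<open>l' \<in> {1..3}\<close> by (intro contract_dual_eq_0) (auto simp: d)
      then show ?thesis
        using i finI0 by (simp add: sum.remove)
    qed
    have ci: "c i \<noteq> 0" using c i I0A by auto
    have "c i *s contract (a i) f (d (i, n)) \<in> vec.span Z"
      using inZ[of "d (i, n)"] one[OF in3(3)] by simp
    then have "(c i * (f \<odot> a i l)) *s p \<in> vec.span Z"
      unfolding con p_def[symmetric] q_def[symmetric] dp by simp
    then have pZ: "p \<in> vec.span Z"
      by (rule span_scaleD) (use ci l in simp)
    have "c i *s contract (a i) f (d (i, m)) \<in> vec.span Z"
      using inZ[of "d (i, m)"] one[OF in3(2)] by simp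
    then have "(- c i * (f \<odot> a i l)) *s q \<in> vec.span Z"
      unfolding con p_def[symmetric] q_def[symmetric] dp by simp
    then have qZ: "q \<in> vec.span Z"
      by (rule span_scaleD) (use ci l in simp)
    have "{1..3} = {1, 2, 3::nat}" by auto
    then have sp: "a i l' \<in> vec.span {a i 1, a i 2, a i 3}" if "l' \<in> {1..3}" for l'
      using that by (auto intro: vec.span_base)
    then have "p \<in> vec.span {a i 1, a i 2, a i 3}" "q \<in> vec.span {a i 1, a i 2, a i 3}"
      unfolding p_def q_def using in3 by (auto intro!: vec.span_diff vec.span_scale)
    with dp pZ qZ in3 show ?thesis
      by (intro exI[of _ "\<lambda>s. if s then m else n"] exI[of _ "\<lambda>s. if s then p else q"])
        (simp add: Q_def all_bool_eq)
  qed
  from ex obtain P p where "\<And>i. i \<in> I0 \<Longrightarrow> Q i (P i) (p i)"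
    by metis
  then have Pp: "p i s \<in> vec.span Z" "P i s \<in> {1..3}" "p i s \<in> vec.span {a i 1, a i 2, a i 3}"
      "d (i, P i s) \<odot> p i t = (if s = t then 1 else 0)" if "i \<in> I0" for i s t
    using that unfolding Q_def by blast+
  have "biorthogonal (I0 \<times> UNIV) (\<lambda>(i, s). d (i, P i s)) (\<lambda>(i, s). p i s)"
    unfolding biorthogonal_def
  proof (intro ballI)
    fix w w' :: "'i \<times> bool" assume "w \<in> I0 \<times> UNIV" "w' \<in> I0 \<times> UNIV"
    then obtain i s i' s' where w: "w = (i, s)" "w' = (i', s')" and i: "i \<in> I0" "i' \<in> I0"
      by blast
    have "d (i, P i s) \<odot> p i' s' = 0" if "i \<noteq> i'"
      by (rule scalar_product_span_eq_0[OF _ Pp(3)[OF i(2)]])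
        (use Pp(2)[OF i(1)] that i d in auto)
    then show "(case w of (i, s) \<Rightarrow> d (i, P i s)) \<odot> (case w' of (i, s) \<Rightarrow> p i s) = (if w = w' then 1 else 0)"
      using Pp(4)[OF i(1)] by (cases "i = i'") (auto simp: w)
  qed
  from biorthogonal_card_le[OF this _ finZ] have "card (I0 \<times> (UNIV :: bool set)) \<le> card Z"
    using Pp finI0 by auto
  then have "card I0 \<le> card ?I - card I0 + card ?I'"
    using cardZ by (simp add: card_cartesian_product)
  moreover have "card ?I \<le> card A" using IA fin by (simp add: card_mono)
  ultimately show ?thesis
    using I0(2) small by (auto simp: min_def split: if_splits)
qed

section \<open>Generic functionals over the rational function field\<close>

lemma linear_with_kernel:
  fixes W :: "('a::field ^ 'n) set"
  assumes W: "vec.subspace W"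
  obtains g :: "'a ^ 'n \<Rightarrow> 'a ^ 'n" where "Vector_Spaces.linear (*s) (*s) g" "\<And>x. g x = 0 \<longleftrightarrow> x \<in> W"
proof -
  obtain B where B: "B \<subseteq> W" "vec.independent B" "W \<subseteq> vec.span B"
    using vec.basis_exists by metis
  then have WB: "W = vec.span B" using W vec.span_minimal by blast
  obtain C where C: "B \<subseteq> C" "vec.independent C" "UNIV \<subseteq> vec.span C"
    using vec.maximal_independent_subset_extend[of B UNIV] B by auto
  obtain g :: "'a ^ 'n \<Rightarrow> 'a ^ 'n" where g: "Vector_Spaces.linear (*s) (*s) g"
      "\<And>v. v \<in> C \<Longrightarrow> g v = (if v \<in> B then 0 else v)"
    using vec.linear_independent_extend[OF C(2), of "\<lambda>v. if v \<in> B then 0 else v"] by blast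
  interpret g: Vector_Spaces.linear "(*s)" "(*s)" g by (rule g)
  have g0: "g y = 0" if "y \<in> vec.span B" for y
    by (rule g.eq_0_on_span[OF _ that]) (use g(2) C in auto)
  have gid: "g z = z" if "z \<in> vec.span (C - B)" for z
    using vec.linear_eq_on[OF g(1) vec.linear_ident that] g(2) by auto
  have "x \<in> W" if "g x = 0" for x
  proof -
    have "x \<in> vec.span (B \<union> (C - B))" using C(1,3) by (simp add: Un_absorb1 subset_UNIV) blast
    then obtain y z where "x = y + z" "y \<in> vec.span B" "z \<in> vec.span (C - B)"
      unfolding vec.span_Un by blast
    then show ?thesis using that g0 gid by (simp add: g.add WB)
  qed
  then show thesis using that[of g] g g0 WB by blast
qed

definition const_fract :: "'a::field \<Rightarrow> 'a poly fract" where
  "const_fract c = to_fract [:c:]"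

definition const_vec :: "'a::field ^ 'n \<Rightarrow> 'a poly fract ^ 'n" where
  "const_vec x = (\<chi> i. const_fract (x $ i))"

lemma const_fract_simps [simp]:
  "const_fract (x + y) = const_fract x + const_fract y"
  "const_fract (x - y) = const_fract x - const_fract y"
  "const_fract (x * y) = const_fract x * const_fract y"
  "const_fract 0 = 0" "const_fract 1 = 1"
  by (simp_all add: const_fract_def flip: to_fract_add to_fract_diff to_fract_mult one_pCons)

lemma const_fract_sum: "const_fract (sum f A) = (\<Sum>x\<in>A. const_fract (f x))"
  by (induction A rule: infinite_finite_induct) auto

lemma const_vec_scalar_product: "const_vec x \<odot> const_vec y = const_fract (x \<odot> y)"
  by (simp add: scalar_product_def const_vec_def const_fract_sum)

lemma alt3_const_vec: "alt3 (\<lambda>l. const_vec (x l)) i j k = const_fract (alt3 x i j k)"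
  by (simp add: alt3_def const_vec_def)

text \<open>
  Over a small field, a functional that vanishes on \<open>W\<close> may be forced to vanish on one of finitely
  many given vectors outside \<open>W\<close>. Over \<open>K(t)\<close> the functional \<open>\<Sum>l. t ^ l * g\<^sub>l\<close>, with \<open>g\<^sub>l\<close> the
  coordinates of a linear map with kernel \<open>W\<close>, avoids this.
\<close>

lemma generic_functional:
  fixes W :: "('a::field ^ 'n) set"
  assumes "vec.subspace W"
  obtains f where "\<And>x. f \<odot> const_vec x = 0 \<longleftrightarrow> x \<in> W"
proof -
  obtain g :: "'a ^ 'n \<Rightarrow> 'a ^ 'n" where g: "Vector_Spaces.linear (*s) (*s) g" "\<And>x. g x = 0 \<longleftrightarrow> x \<in> W"
    using linear_with_kernel[OF assms] by blast
  obtain e :: "'n \<Rightarrow> nat" where e: "inj e"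
    using finite_imp_inj_to_nat_seg[of "UNIV :: 'n set"] by auto
  define f :: "'a poly fract ^ 'n" where
    "f = (\<chi> i. \<Sum>l\<in>UNIV. to_fract (monom (matrix g $ l $ i) (e l)))"
  have "f \<odot> const_vec x = 0 \<longleftrightarrow> x \<in> W" for x
  proof -
    have "f \<odot> const_vec x = (\<Sum>i\<in>UNIV. \<Sum>l\<in>UNIV. to_fract (monom (matrix g $ l $ i * x $ i) (e l)))"
      by (simp add: scalar_product_def f_def const_vec_def const_fract_def sum_distrib_left
          smult_monom mult.commute flip: to_fract_mult)
    also have "\<dots> = (\<Sum>l\<in>UNIV. \<Sum>i\<in>UNIV. to_fract (monom (matrix g $ l $ i * x $ i) (e l)))"
      by (rule sum.swap)
    also have "\<dots> = to_fract (\<Sum>l\<in>UNIV. monom ((matrix g *v x) $ l) (e l))"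
      by (simp add: to_fract_sum matrix_vector_mult_def monom_sum)
    also have "matrix g *v x = g x" by (rule matrix_works[OF g(1)])
    finally have eq: "f \<odot> const_vec x = 0 \<longleftrightarrow> (\<Sum>l\<in>UNIV. monom (g x $ l) (e l)) = 0"
      by (simp only: to_fract_eq_0_iff)
    have "poly.coeff (\<Sum>l\<in>UNIV. monom (g x $ l) (e l)) (e l') = g x $ l'" for l'
      by (simp add: coeff_sum inj_eq[OF e] sum.delta)
    then have "(\<Sum>l\<in>UNIV. monom (g x $ l) (e l)) = 0 \<longleftrightarrow> g x = 0"
      by (metis (no_types, lifting) coeff_0 monom_eq_0 sum.neutral vec_eq_iff zero_index)
    then show ?thesis using eq g(2) by simp
  qed
  then show thesis by (rule that)
qed

section \<open>From functionals to subspaces\<close>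

definition contained :: "('i \<Rightarrow> nat \<Rightarrow> 'a::field ^ 'n) \<Rightarrow> ('a ^ 'n) set \<Rightarrow> 'i set \<Rightarrow> 'i set" where
  "contained a W A = {i \<in> A. \<forall>l\<in>{1..3}. a i l \<in> W}"

lemma sum_contract_nth:
  "(\<Sum>s\<in>A. contract (a s) f x) $ j = (\<Sum>i\<in>UNIV. \<Sum>k\<in>UNIV. f $ i * x $ k * (\<Sum>s\<in>A. alt3 (a s) i j k))"
  by (simp add: contract_nth sum_distrib_left sum.swap[of _ A])

lemma sum_contract:
  assumes "\<And>i j k. (\<Sum>s\<in>A. alt3 (a s) i j k) = (\<Sum>t\<in>B. alt3 (b t) i j k)"
  shows "(\<Sum>s\<in>A. contract (a s) f x) = (\<Sum>t\<in>B. contract (b t) f x)"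
  using assms by (simp only: vec_eq_iff sum_contract_nth) simp

text \<open>The generic functional of \<open>W\<close> touches exactly the terms not contained in
  \<open>W\<close>. Equality of the sums and the dual families carry over to \<open>K(t)\<close>, so
  the rank comparison applies there.\<close>

lemma card_contained_diff_le:
  fixes a :: "'i \<Rightarrow> nat \<Rightarrow> 'a::field ^ 'n" and b :: "'j \<Rightarrow> nat \<Rightarrow> 'a ^ 'n"
  assumes fin: "finite A" "finite B"
    and eq: "\<And>i j k. (\<Sum>s\<in>A. alt3 (a s) i j k) = (\<Sum>t\<in>B. alt3 (b t) i j k)"
    and dual: "\<And>J. J \<subseteq> A \<Longrightarrow> card J \<le> k \<Longrightarrow> \<exists>d. biorthogonal (J \<times> {1..3}) d (\<lambda>(i, l). a i l)"
    and W: "vec.subspace W"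
    and small: "card (B - contained b W B) + card A < 2 * k"
  shows "card (A - contained a W A) \<le> card (B - contained b W B)"
proof -
  obtain f where f: "\<And>x. f \<odot> const_vec x = 0 \<longleftrightarrow> x \<in> W"
    using generic_functional[OF W] by blast
  have tA: "touching (\<lambda>i l. const_vec (a i l)) f A = A - contained a W A"
    and tB: "touching (\<lambda>i l. const_vec (b i l)) f B = B - contained b W B"
    unfolding touching_def contained_def f by blast+
  have "card (touching (\<lambda>i l. const_vec (a i l)) f A) \<le> card (touching (\<lambda>i l. const_vec (b i l)) f B)"
  proof (rule card_touching_le[OF fin])
    fix x
    show "(\<Sum>i\<in>A. 1 *s contract (\<lambda>l. const_vec (a i l)) f x) = (\<Sum>j\<in>B. contract (\<lambda>l. const_vec (b j l)) f x)"
      unfolding vec.scale_one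
      by (rule sum_contract) (simp add: alt3_const_vec eq flip: const_fract_sum)
  next
    fix J assume J: "J \<subseteq> A" "card J \<le> k"
    obtain d where "biorthogonal (J \<times> {1..3}) d (\<lambda>(i, l). a i l)" using dual[OF J] by blast
    then have "biorthogonal (J \<times> {1..3}) (\<lambda>s. const_vec (d s)) (\<lambda>(i, l). const_vec (a i l))"
      unfolding biorthogonal_def by (simp add: split_beta const_vec_scalar_product)
    then show "\<exists>d. biorthogonal (J \<times> {1..3}) d (\<lambda>(i, l). const_vec (a i l))" by blast
  qed (use small in \<open>simp_all add: tB\<close>)
  then show ?thesis by (simp add: tA tB)
qed

section \<open>Intersections of spans and proportional wedge products\<close>

lemma biorthogonal_span_Int:
  assumes bi: "biorthogonal K d x" and P: "finite P" "P \<subseteq> K" and Q: "Q \<subseteq> K"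
    and y: "y \<in> vec.span (x ` P)" "y \<in> vec.span (x ` Q)"
  shows "y \<in> vec.span (x ` (P \<inter> Q))"
proof -
  have d: "d s \<odot> x t = (if s = t then 1 else 0)" if "s \<in> K" "t \<in> K" for s t
    using bi that by (simp add: biorthogonal_def)
  have inj: "inj_on x P"
    by (intro inj_onI) (metis d P(2) subsetD zero_neq_one)
  obtain u where "y = (\<Sum>v\<in>x ` P. u v *s v)"
    using y(1) P(1) by (auto simp: vec.span_finite)
  then have yu: "y = (\<Sum>p\<in>P. u (x p) *s x p)" by (simp add: sum.reindex[OF inj])
  have u0: "u (x p) = 0" if p: "p \<in> P - Q" for p
  proof -
    have "0 = d p \<odot> y"
      by (rule sym, rule scalar_product_span_eq_0[OF _ y(2)]) (use p P Q in \<open>auto simp: d subset_iff\<close>)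
    also have "\<dots> = (\<Sum>t\<in>P. if p = t then u (x t) else 0)"
      unfolding yu scalar_product_sum by (rule sum.cong) (use p P in \<open>auto simp: d subset_iff\<close>)
    also have "\<dots> = u (x p)" using p P by simp
    finally show ?thesis by simp
  qed
  have "y = (\<Sum>p\<in>P \<inter> Q. u (x p) *s x p)"
    unfolding yu by (rule sum.mono_neutral_right) (use P u0 in auto)
  also have "\<dots> \<in> vec.span (x ` (P \<inter> Q))"
    by (intro vec.span_sum vec.span_scale vec.span_base) auto
  finally show ?thesis .
qed

text \<open>Multiplicativity of the determinant: the minors of \<open>a\<close> are those of
  \<open>b\<close> times the determinant of the coefficient matrix, which does not depend on the
  coordinates chosen.\<close>

lemma alt3_in_span:
  fixes a b :: "nat \<Rightarrow> 'a::field ^ 'n"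
  assumes "\<And>l. l \<in> {1..3} \<Longrightarrow> a l \<in> vec.span {b 1, b 2, b 3}"
  obtains c where "\<And>i j k. alt3 a i j k = c * alt3 b i j k"
proof -
  have ex: "\<exists>p q s. y = p *s b 1 + q *s b 2 + s *s b 3" if y: "y \<in> vec.span {b 1, b 2, b 3}" for y
  proof -
    obtain p q s where "y - p *s b 1 - q *s b 2 - s *s b 3 = 0"
      using y by (auto simp: vec.span_insert)
    then show ?thesis by (intro exI[of _ p] exI[of _ q] exI[of _ s]) (simp add: algebra_simps)
  qed
  obtain p1 q1 s1 p2 q2 s2 p3 q3 s3 where C: "a 1 = p1 *s b 1 + q1 *s b 2 + s1 *s b 3"
      "a 2 = p2 *s b 1 + q2 *s b 2 + s2 *s b 3" "a 3 = p3 *s b 1 + q3 *s b 2 + s3 *s b 3"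
    using ex[OF assms[of 1]] ex[OF assms[of 2]] ex[OF assms[of 3]] by auto
  define M :: "(nat \<Rightarrow> 'a ^ 'n) \<Rightarrow> 'n \<Rightarrow> 'n \<Rightarrow> 'n \<Rightarrow> 'a ^ 3 ^ 3" where
    "M x i j k = vector [vector [x 1 $ i, x 2 $ i, x 3 $ i], vector [x 1 $ j, x 2 $ j, x 3 $ j],
      vector [x 1 $ k, x 2 $ k, x 3 $ k]]" for x i j k
  define N :: "'a ^ 3 ^ 3" where
    "N = vector [vector [p1, p2, p3], vector [q1, q2, q3], vector [s1, s2, s3]]"
  have det: "alt3 x i j k = det (M x i j k)" for x i j k
    unfolding alt3_def M_def det_3 vector_3 by (simp add: algebra_simps)
  have "M a i j k = M b i j k ** N" for i j k
    unfolding M_def N_def vec_eq_iff forall_3 matrix_matrix_mult_def sum_3 vec_lambda_beta vector_3 C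
      vector_add_component vector_smult_component
    by (simp only: mult.commute simp_thms)
  then have "alt3 a i j k = det N * alt3 b i j k" for i j k
    unfolding det by (simp add: det_mul mult.commute)
  then show thesis by (rule that)
qed

section \<open>Kruskal's count and the matching of terms\<close>

text \<open>A common index set is possible because the shorter expression is padded with zeros.
  Independence is assumed for \<open>a\<close> only; for \<open>b\<close> it is derived. The bound
  \<open>k_ge\<close> is the inequality \<open>2r \<le> 3k - 2\<close>.\<close>

locale equal_wedge_sums =
  fixes R :: "'i set" and a b :: "'i \<Rightarrow> nat \<Rightarrow> 'a::field ^ 'n" and k :: nat
  assumes fin: "finite R"
    and eq: "\<And>p q s. (\<Sum>i\<in>R. alt3 (a i) p q s) = (\<Sum>i\<in>R. alt3 (b i) p q s)"
    and dual: "\<And>J. J \<subseteq> R \<Longrightarrow> card J \<le> k \<Longrightarrow> \<exists>d. biorthogonal (J \<times> {1..3}) d (\<lambda>(i, l). a i l)"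
    and k_le: "k \<le> card R" and k_ge: "2 * card R + 2 \<le> 3 * k"
begin

text \<open>The sum of the spaces \<open>V\<^sub>j\<close> with \<open>j \<in> J\<close>.\<close>

definition W :: "'i set \<Rightarrow> ('a ^ 'n) set" where
  "W J = vec.span ((\<lambda>(i, l). b i l) ` (J \<times> {1..3}))"

abbreviation inside :: "'i set \<Rightarrow> 'i set" where
  "inside J \<equiv> contained a (W J) R"

lemma in_W: "j \<in> J \<Longrightarrow> l \<in> {1..3} \<Longrightarrow> b j l \<in> W J"
  unfolding W_def by (rule vec.span_base) force

lemma card_inside_ge_of_large:
  assumes J: "J \<subseteq> R" "k - 1 \<le> card J"
  shows "card J \<le> card (inside J)"
proof -
  let ?V = "contained b (W J) R"
  have JV: "J \<subseteq> ?V" using J in_W by (auto simp: contained_def)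
  have sub: "?V \<subseteq> R" "inside J \<subseteq> R" by (auto simp: contained_def)
  have cJV: "card J \<le> card ?V" using JV sub fin by (meson card_mono finite_subset)
  have "card (R - inside J) \<le> card (R - ?V)"
  proof (rule card_contained_diff_le[OF fin fin eq dual])
    show "vec.subspace (W J)" by (simp add: W_def)
    \<comment> \<open>At most \<open>card R - (k - 1)\<close> terms lie outside, so by
      \<open>k_ge\<close> the left side is at most \<open>2 * k - 1\<close>.\<close>
    show "card (R - ?V) + card R < 2 * k"
      using cJV J(2) k_ge k_le sub fin by (simp add: card_Diff_subset finite_subset)
  qed
  moreover have "card ?V \<le> card R" "card (inside J) \<le> card R"
    using sub fin by (auto intro: card_mono)
  ultimately have "card ?V \<le> card (inside J)"
    using sub fin by (simp add: card_Diff_subset finite_subset)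
  then show ?thesis using cJV by simp
qed

text \<open>Enlarge \<open>J\<close> to \<open>k\<close> indices. Their \<open>W\<close> contains
  \<open>k\<close> of the spaces of \<open>a\<close>, hence \<open>3 * k\<close> independent
  vectors, while it has only \<open>3 * k\<close> generators; so these are independent.\<close>

lemma dual_b:
  assumes J: "J \<subseteq> R" "card J \<le> k"
  shows "\<exists>d. biorthogonal (J \<times> {1..3}) d (\<lambda>(i, l). b i l)"
proof -
  obtain J' where J': "J \<subseteq> J'" "J' \<subseteq> R" "card J' = k"
    using exists_subset_between[OF J(2) k_le J(1) fin] by blast
  obtain I where I: "I \<subseteq> inside J'" "card I = k"
    using card_inside_ge_of_large[OF J'(2)] J'(3) by (metis diff_le_self obtain_subset_with_card_n)
  then have IR: "I \<subseteq> R" by (auto simp: contained_def)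
  then obtain d where d: "biorthogonal (I \<times> {1..3}) d (\<lambda>(i, l). a i l)"
    using dual I by (metis order_refl)
  let ?X = "(\<lambda>(i, l). b i l) ` (J' \<times> {1..3})"
  have finJ: "finite J'" using J' fin finite_subset by blast
  obtain B where B: "B \<subseteq> ?X" "?X \<subseteq> vec.span B" "card B = vec.dim ?X"
    using vec.basis_exists by metis
  have "card (I \<times> {1..3::nat}) \<le> card B"
  proof (rule biorthogonal_card_le[OF d])
    show "finite (I \<times> {1..3::nat})" using IR fin finite_subset by blast
    show "finite B" using B finJ finite_subset by blast
    fix s assume "s \<in> I \<times> {1..3::nat}"
    then have "(case s of (i, l) \<Rightarrow> a i l) \<in> W J'" using I by (auto simp: contained_def)
    then show "(case s of (i, l) \<Rightarrow> a i l) \<in> vec.span B"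
      using vec.span_minimal[OF B(2) vec.subspace_span] by (auto simp: W_def)
  qed
  then have "card (J' \<times> {1..3::nat}) \<le> vec.dim ?X"
    using I(2) J'(3) B(3) by (simp add: card_cartesian_product)
  then obtain d' where "biorthogonal (J' \<times> {1..3}) d' (\<lambda>(i, l). b i l)"
    using biorthogonal_exists finJ by (metis finite_SigmaI finite_atLeastAtMost)
  then show ?thesis using biorthogonal_subset J'(1) by (metis Sigma_mono order_refl)
qed

lemma W_Int:
  assumes "I \<union> J \<subseteq> R" "card (I \<union> J) \<le> k" "y \<in> W I" "y \<in> W J"
  shows "y \<in> W (I \<inter> J)"
proof -
  obtain d where d: "biorthogonal ((I \<union> J) \<times> {1..3}) d (\<lambda>(i, l). b i l)"
    using dual_b assms by blast
  have "finite I" using assms fin by (meson finite_subset le_sup_iff)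
  moreover have "(I \<inter> J) \<times> {1..3::nat} = (I \<times> {1..3}) \<inter> (J \<times> {1..3})" by blast
  ultimately show ?thesis
    using biorthogonal_span_Int[OF d, of "I \<times> {1..3}" "J \<times> {1..3}" y] assms
    by (auto simp: W_def)
qed

text \<open>Descending induction on \<open>card J\<close>. Adding any \<open>j\<close> outside
  \<open>J\<close> yields at least \<open>card J + 1\<close> contained terms, and the terms gained
  for different \<open>j\<close> are disjoint. If fewer than \<open>card J\<close> terms were inside
  \<open>J\<close>, these gains would together exceed the terms available.\<close>

lemma card_inside_ge:
  assumes "J \<subseteq> R" "card J \<le> k - 1"
  shows "card J \<le> card (inside J)"
  using assms
proof (induction "k - 1 - card J" arbitrary: J)
  case 0
  then show ?case using card_inside_ge_of_large by simp
next
  case (Suc n)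
  let ?X = "\<lambda>j. inside (insert j J) - inside J"
  have finJ: "finite J" using Suc fin finite_subset by blast
  have small: "card J + 2 \<le> k" using Suc by linarith
  have finX: "finite (inside K)" for K using fin by (simp add: contained_def)
  have ge: "card J + 1 - card (inside J) \<le> card (?X j)" if j: "j \<in> R - J" for j
  proof -
    have c: "card (insert j J) = card J + 1" using j finJ by simp
    have "card J + 1 \<le> card (inside (insert j J))"
      using Suc(1)[of "insert j J"] Suc(2-) j unfolding c by simp
    moreover have "card (inside (insert j J)) - card (inside J) \<le> card (?X j)"
      by (rule diff_card_le_card_Diff[OF finX])
    ultimately show ?thesis by linarith
  qed
  \<comment> \<open>The two enlarged sets have a union of size \<open>card J + 2 \<le> k\<close>, so
    \<open>W_Int\<close> puts a common new term back into \<open>W J\<close>.\<close>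
  have disj: "?X j \<inter> ?X j' = {}" if j: "j \<in> R - J" "j' \<in> R - J" "j \<noteq> j'" for j j'
  proof (rule ccontr)
    assume "?X j \<inter> ?X j' \<noteq> {}"
    then obtain i where i: "i \<in> R" "i \<in> inside (insert j J)" "i \<in> inside (insert j' J)" "i \<notin> inside J"
      by (auto simp: contained_def)
    have "a i l \<in> W J" if l: "l \<in> {1..3}" for l
    proof -
      have "a i l \<in> W (insert j J \<inter> insert j' J)"
        by (rule W_Int) (use i l j Suc finJ small in \<open>auto simp: contained_def card_insert_if\<close>)
      moreover have "insert j J \<inter> insert j' J = J" using j by blast
      ultimately show ?thesis by simp
    qed
    then show False using i by (auto simp: contained_def)
  qed
  have "(card R - card J) * (card J + 1 - card (inside J)) = (\<Sum>j\<in>R - J. card J + 1 - card (inside J))"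
    using Suc finJ by (simp add: card_Diff_subset)
  also have "\<dots> \<le> (\<Sum>j\<in>R - J. card (?X j))" by (rule sum_mono[OF ge])
  also have "\<dots> = card (\<Union>j\<in>R - J. ?X j)"
    by (rule card_UN_disjoint[symmetric]) (use fin finX disj in auto)
  also have "\<dots> \<le> card (R - inside J)"
    by (intro card_mono) (use fin in \<open>auto simp: contained_def\<close>)
  also have "\<dots> = card R - card (inside J)"
    using finX by (intro card_Diff_subset) (auto simp: contained_def)
  finally have *: "(card R - card J) * (card J + 1 - card (inside J)) \<le> card R - card (inside J)" .
  show ?case
  proof (rule ccontr)
    assume "\<not> ?thesis"
    \<comment> \<open>\<open>e\<close> and \<open>p\<close> turn the truncated differences in
      \<open>*\<close> into sums; \<open>p\<close> exists because
      \<open>card J + 2 \<le> k \<le> card R\<close>.\<close>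
    then obtain e where e: "card J = card (inside J) + Suc e"
      by (metis less_imp_Suc_add not_le add_Suc_right)
    obtain p where p: "card R = card J + 2 + p" using small k_le by (metis le_add_diff_inverse le_trans)
    have "(2 + p) * (e + 2) \<le> 3 + p + e" using * unfolding p e by simp
    then show False by (simp add: algebra_simps)
  qed
qed

text \<open>Singletons \<open>J\<close> give each \<open>V\<^sub>j\<close> a space of
  \<open>a\<close> inside it. Two indices cannot share one, since their spaces meet in 0.
  Corresponding terms are then proportional, and it remains to show that all factors
  \<open>c j\<close> are 1.\<close>

lemma matching:
  obtains \<pi> where "bij_betw \<pi> R R" "\<And>j p q s. j \<in> R \<Longrightarrow> alt3 (a (\<pi> j)) p q s = alt3 (b j) p q s"
proof -
  have k2: "2 \<le> k" using k_ge k_le by linarith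
  have "inside {j} \<noteq> {}" if "j \<in> R" for j
    using card_inside_ge[of "{j}"] that k2 by force
  then have "\<forall>j\<in>R. \<exists>i. i \<in> inside {j}" by blast
  then obtain \<pi> where \<pi>: "\<And>j. j \<in> R \<Longrightarrow> \<pi> j \<in> inside {j}" unfolding bchoice_iff by blast
  have \<pi>R: "\<pi> ` R \<subseteq> R" using \<pi> by (auto simp: contained_def)
  have "inj_on \<pi> R"
  proof (rule inj_onI, rule ccontr)
    fix j j' assume j: "j \<in> R" "j' \<in> R" "\<pi> j = \<pi> j'" "j \<noteq> j'"
    have "a (\<pi> j) 1 \<in> W ({j} \<inter> {j'})"
      by (rule W_Int) (use j k2 \<pi>[OF j(1)] \<pi>[OF j(2)] in \<open>auto simp: contained_def card_insert_if\<close>)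
    then have "a (\<pi> j) 1 = 0" using j by (simp add: W_def)
    moreover obtain d where "biorthogonal ({\<pi> j} \<times> {1..3}) d (\<lambda>(i, l). a i l)"
      using dual[of "{\<pi> j}"] \<pi>R j k2 by auto
    then have "d (\<pi> j, 1) \<odot> a (\<pi> j) 1 = 1" unfolding biorthogonal_def by fastforce
    ultimately show False by simp
  qed
  then have bij: "bij_betw \<pi> R R"
    using \<pi>R fin by (simp add: bij_betw_def endo_inj_surj)
  have "\<exists>c. \<forall>p q s. alt3 (a (\<pi> j)) p q s = c * alt3 (b j) p q s" if j: "j \<in> R" for j
  proof -
    have "(\<lambda>(i, l). b i l) ` ({j} \<times> {1..3}) = {b j 1, b j 2, b j 3}"
    proof -
      have "{1..3} = {1, 2, 3::nat}" by auto
      then show ?thesis by simp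
    qed
    then have "a (\<pi> j) l \<in> vec.span {b j 1, b j 2, b j 3}" if "l \<in> {1..3}" for l
      using \<pi>[OF j] that by (auto simp: contained_def W_def)
    then show ?thesis by (metis alt3_in_span)
  qed
  then obtain c where c: "\<And>j p q s. j \<in> R \<Longrightarrow> alt3 (a (\<pi> j)) p q s = c j * alt3 (b j) p q s"
    by metis
  define I where "I = {j \<in> R. c j \<noteq> 1}"
  have I: "finite I" "I \<subseteq> R" using fin by (auto simp: I_def)
  have zero: "(\<Sum>j\<in>I. (c j - 1) *s contract (b j) f x) = 0" for f x
  proof -
    have "(\<Sum>j\<in>R. c j *s contract (b j) f x) = (\<Sum>j\<in>R. contract (a (\<pi> j)) f x)"
      by (rule sum.cong) (simp_all add: vec_eq_iff contract_nth c sum_distrib_left mult_ac)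
    also have "\<dots> = (\<Sum>i\<in>R. contract (a i) f x)"
      by (rule sum.reindex_bij_betw[OF bij])
    also have "\<dots> = (\<Sum>j\<in>R. contract (b j) f x)" by (rule sum_contract[OF eq])
    finally have "(\<Sum>j\<in>R. (c j - 1) *s contract (b j) f x) = 0"
      by (simp add: vec.scale_left_diff_distrib sum_subtractf)
    also have "(\<Sum>j\<in>R. (c j - 1) *s contract (b j) f x) = (\<Sum>j\<in>I. (c j - 1) *s contract (b j) f x)"
      by (rule sum.mono_neutral_right[OF fin I(2)]) (simp add: I_def)
    finally show ?thesis .
  qed
  have "I = {}"
  proof (rule ccontr)
    assume "I \<noteq> {}"
    then obtain j where j: "j \<in> I" by blast
    \<comment> \<open>The terms with \<open>c j \<noteq> 1\<close> form a vanishing combination.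
      Compared with the empty sum, none of them can be touched by any functional, yet
      \<open>d (j, 1)\<close> touches term \<open>j\<close>.\<close>
    obtain d where "biorthogonal ({j} \<times> {1..3}) d (\<lambda>(i, l). b i l)"
      using dual_b[of "{j}"] I j k2 by auto
    then have "d (j, 1) \<odot> b j 1 = 1" unfolding biorthogonal_def by fastforce
    then have "j \<in> touching b (d (j, 1)) I"
      using j by (auto simp: touching_def intro!: bexI[of _ 1])
    moreover have "card (touching b (d (j, 1)) I) \<le> card (touching b (d (j, 1)) ({} :: 'i set))"
    proof (rule card_touching_le[OF I(1), where c = "\<lambda>j. c j - 1"])
      show "(\<Sum>i\<in>I. (c i - 1) *s contract (b i) (d (j, 1)) x) = (\<Sum>i\<in>{}. contract (b i) (d (j, 1)) x)" for x
        by (simp only: zero sum.empty)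
      show "card (touching b (d (j, 1)) ({} :: 'i set)) + card I < 2 * k"
        using card_mono[OF fin I(2)] k_ge k2 by (simp add: touching_def)
      show "\<exists>d. biorthogonal (J \<times> {1..3}) d (\<lambda>(i, l). b i l)" if "J \<subseteq> I" "card J \<le> k" for J
        using dual_b that I by blast
    qed (auto simp: I_def)
    moreover have "finite (touching b (d (j, 1)) I)" using I by (simp add: touching_def)
    ultimately show False by (auto simp: touching_def)
  qed
  then have "c j = 1" if "j \<in> R" for j using that by (auto simp: I_def)
  then show thesis using that[OF bij] c by simp
qed

end

section \<open>Dual families from the Kruskal rank\<close>

text \<open>Cramer's rule: the cofactors of the nonzero minor, divided by it, form a dual family of
  the three vectors.\<close>

lemma dim_of_alt3_nonzero:
  fixes x :: "nat \<Rightarrow> 'a::field ^ 'n"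
  assumes nz: "alt3 x i j k \<noteq> 0"
  shows "vec.dim {x 1, x 2, x 3} = 3"
proof -
  define cof :: "'a ^ 'n \<Rightarrow> 'a ^ 'n \<Rightarrow> 'a ^ 'n" where
    "cof u v = (1 / alt3 x i j k) *s ((u $ j * v $ k - v $ j * u $ k) *s axis i 1
      + (v $ i * u $ k - u $ i * v $ k) *s axis j 1 + (u $ i * v $ j - v $ i * u $ j) *s axis k 1)" for u v
  have axis: "axis i 1 \<odot> v = v $ i" for i and v :: "'a ^ 'n"
    by (simp add: scalar_product_def axis_def if_distrib[of "\<lambda>c. c * _"] cong: if_cong)
  have cof: "cof u v \<odot> w = (w $ i * (u $ j * v $ k - v $ j * u $ k) + w $ j * (v $ i * u $ k - u $ i * v $ k)
      + w $ k * (u $ i * v $ j - v $ i * u $ j)) / alt3 x i j k" for u v w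
    unfolding cof_def scalar_product_linear axis by (simp add: mult.commute)
  have eq3: "{1..3} = {1, 2, 3::nat}" by auto
  have bi: "biorthogonal {1..3} (\<lambda>l. if l = 1 then cof (x 2) (x 3) else if l = 2 then cof (x 3) (x 1)
      else cof (x 1) (x 2)) x"
    unfolding biorthogonal_def eq3 using nz by (auto simp: cof divide_simps) (auto simp: alt3_def algebra_simps)
  obtain B where B: "B \<subseteq> {x 1, x 2, x 3}" "{x 1, x 2, x 3} \<subseteq> vec.span B" "card B = vec.dim {x 1, x 2, x 3}"
    using vec.basis_exists by metis
  have "card {1..3::nat} \<le> card B"
  proof (rule biorthogonal_card_le[OF bi])
    show "finite B" using B(1) finite_subset by blast
    show "x l \<in> vec.span B" if "l \<in> {1..3}" for l
      using that B(2) unfolding eq3 by blast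
  qed simp
  moreover have "card B \<le> 3"
    using card_mono[OF _ B(1)] card_length[of "[x 1, x 2, x 3]"] by simp
  ultimately show ?thesis using B(3) by simp
qed

text \<open>The set under \<open>Max\<close> is bounded by \<open>r\<close> and contains 0, the
  empty sum being \<open>{0}\<close>; so the maximum is attained.\<close>

lemma kruskal_rank_le: "kruskal_rank r U \<le> r"
  and dim_sum_kruskal_rank: "J \<subseteq> {1..r} \<Longrightarrow> card J = kruskal_rank r U \<Longrightarrow>
    vec.dim (\<Sum>i\<in>J. U i) = (\<Sum>i\<in>J. vec.dim (U i))"
proof -
  let ?S = "{l. l \<le> r \<and>
     (\<forall>J. J \<subseteq> {1..r} \<and> card J = l \<longrightarrow> vec.dim (\<Sum>i\<in>J. U i) = (\<Sum>i\<in>J. vec.dim (U i)))}"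
  have "vec.dim (\<Sum>i\<in>J. U i) = (\<Sum>i\<in>J. vec.dim (U i))" if "J \<subseteq> {1..r}" "card J = 0" for J
  proof -
    have "J = {}" using that finite_subset by (metis card_0_eq finite_atLeastAtMost)
    moreover have "vec.dim {0 :: 'a ^ 'b} = 0" using vec.dim_span[of "{}"] by (simp add: vec.span_empty)
    ultimately show ?thesis by (simp add: set_zero)
  qed
  then have "0 \<in> ?S" by blast
  then have "kruskal_rank r U \<in> ?S"
    unfolding kruskal_rank_def by (intro Max_in) auto
  then show "kruskal_rank r U \<le> r" and "J \<subseteq> {1..r} \<Longrightarrow> card J = kruskal_rank r U \<Longrightarrow>
      vec.dim (\<Sum>i\<in>J. U i) = (\<Sum>i\<in>J. vec.dim (U i))"
    by blast+
qed

text \<open>A nonzero wedge product has a 3-dimensional span. After enlarging \<open>J\<close> to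
  exactly \<open>kruskal_rank r U\<close> indices, the direct sum has dimension three times that
  number, so its generators are independent.\<close>

lemma biorthogonal_of_kruskal_rank:
  fixes a :: "nat \<Rightarrow> nat \<Rightarrow> 'a::field ^ 'n"
  assumes U: "\<And>i. i \<in> {1..r} \<Longrightarrow> U i = vec.span {a i 1, a i 2, a i 3}"
    and nz: "\<And>i. i \<in> {1..r} \<Longrightarrow> wedge3 (a i) \<noteq> 0"
    and J: "J \<subseteq> {1..r}" "card J \<le> kruskal_rank r U"
  shows "\<exists>d. biorthogonal (J \<times> {1..3}) d (\<lambda>(i, l). a i l)"
proof -
  obtain J' where J': "J \<subseteq> J'" "J' \<subseteq> {1..r}" "card J' = kruskal_rank r U"
    using exists_subset_between[OF J(2) _ J(1)] kruskal_rank_le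
    by (metis card_atLeastAtMost diff_Suc_1 finite_atLeastAtMost)
  have fin: "finite J'" using J'(2) finite_subset by blast
  let ?X = "(\<lambda>(i, l). a i l) ` (J' \<times> {1..3})"
  have "vec.dim (U i) = 3" if i: "i \<in> J'" for i
  proof -
    have "\<exists>p q s. alt3 (a i) p q s \<noteq> 0"
      using nz[of i] i J'(2) by (auto simp: vec_eq_iff wedge3_nth)
    then show ?thesis using U[of i] i J'(2) dim_of_alt3_nonzero[of "a i"] by (auto simp: vec.dim_span)
  qed
  then have "card (J' \<times> {1..3::nat}) = vec.dim (\<Sum>i\<in>J'. U i)"
    using dim_sum_kruskal_rank[OF J'(2,3)] by (simp add: card_cartesian_product)
  also have "(\<Sum>i\<in>J'. U i) \<subseteq> vec.span ?X"
  proof -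
    have "U i \<subseteq> vec.span ?X" if i: "i \<in> J'" for i
    proof -
      have "{a i 1, a i 2, a i 3} \<subseteq> ?X" using i by force
      then show ?thesis
        using U[of i] i J'(2) vec.span_mono[of "{a i 1, a i 2, a i 3}" ?X] by (metis subsetD)
    qed
    then show ?thesis
      by (auto simp: set_sum_alt[OF fin] intro!: vec.span_sum)
  qed
  then have "vec.dim (\<Sum>i\<in>J'. U i) \<le> vec.dim ?X"
    using vec.dim_subset[of _ "vec.span ?X"] by (simp add: vec.dim_span)
  finally obtain d where "biorthogonal (J' \<times> {1..3}) d (\<lambda>(i, l). a i l)"
    using biorthogonal_exists fin by (metis finite_SigmaI finite_atLeastAtMost)
  then show ?thesis using biorthogonal_subset J'(1) by (metis Sigma_mono order_refl)
qed

section \<open>Uniqueness among expressions with at most \<open>r\<close> terms\<close>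

lemma skew_expression_unique:
  fixes a b :: "nat \<Rightarrow> nat \<Rightarrow> 'a::field ^ 'n"
  assumes r: "r \<ge> 1" and a: "skew_expression T r a" and b: "skew_expression T s b" and sr: "s \<le> r"
    and nz: "\<And>i. i \<in> {1..r} \<Longrightarrow> wedge3 (a i) \<noteq> 0"
    and U: "\<And>i. i \<in> {1..r} \<Longrightarrow> U i = vec.span {a i 1, a i 2, a i 3}"
    and k: "2 * r + 2 \<le> 3 * kruskal_rank r U"
  shows "s = r \<and> image_mset (\<lambda>i. wedge3 (b i)) (mset_set {1..s}) = image_mset (\<lambda>i. wedge3 (a i)) (mset_set {1..r})"
proof -
  \<comment> \<open>\<open>wedge3\<close> divides by 6 and division by zero gives 0, so a nonzero
    wedge product forces 6 to be nonzero.\<close>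
  have six: "(6::'a) \<noteq> 0"
    using nz[of 1] r by (auto simp: vec_eq_iff wedge3_nth)
  define b' where "b' j = (if j \<le> s then b j else (\<lambda>_. 0))" for j
  have w0: "wedge3 (\<lambda>_. 0 :: 'a ^ 'n) = 0"
    by (simp add: vec_eq_iff wedge3_nth alt3_def)
  have "(\<Sum>j = 1..r. wedge3 (b' j)) = (\<Sum>j = 1..s. wedge3 (b' j))"
    by (rule sum.mono_neutral_right) (use sr w0 in \<open>auto simp: b'_def\<close>)
  then have eq: "(\<Sum>i = 1..r. wedge3 (a i)) = (\<Sum>j = 1..r. wedge3 (b' j))"
    using a b by (simp add: skew_expression_def b'_def)
  interpret equal_wedge_sums "{1..r}" a b' "kruskal_rank r U"
  proof
    show "(\<Sum>i = 1..r. alt3 (a i) p q u) = (\<Sum>i = 1..r. alt3 (b' i) p q u)" for p q u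
    proof -
      have "(\<Sum>i = 1..r. wedge3 (a i) $ p $ q $ u) = (\<Sum>j = 1..r. wedge3 (b' j) $ p $ q $ u)"
        using arg_cong[OF eq, of "\<lambda>X. X $ p $ q $ u"] by simp
      then show ?thesis using six by (simp add: wedge3_nth flip: sum_divide_distrib)
    qed
  qed (use k kruskal_rank_le biorthogonal_of_kruskal_rank[OF U nz] in auto)
  obtain \<pi> where bij: "bij_betw \<pi> {1..r} {1..r}"
    and \<pi>: "\<And>j p q u. j \<in> {1..r} \<Longrightarrow> alt3 (a (\<pi> j)) p q u = alt3 (b' j) p q u"
    by (rule matching) blast
  have w: "wedge3 (b' j) = wedge3 (a (\<pi> j))" if "j \<in> {1..r}" for j
    using \<pi>[OF that] by (simp add: vec_eq_iff wedge3_nth)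
  \<comment> \<open>A padding term would be matched with a nonzero term of \<open>a\<close>.\<close>
  have "s = r"
  proof (rule ccontr)
    assume "s \<noteq> r"
    then have "wedge3 (a (\<pi> r)) = 0" using w[of r] w0 r sr by (simp add: b'_def)
    moreover have "\<pi> r \<in> {1..r}" using bij_betwE[OF bij] r by simp
    ultimately show False using nz by blast
  qed
  have "image_mset (\<lambda>i. wedge3 (b i)) (mset_set {1..s}) = image_mset (\<lambda>i. wedge3 (a (\<pi> i))) (mset_set {1..r})"
    unfolding \<open>s = r\<close> by (rule image_mset_cong) (use w \<open>s = r\<close> in \<open>auto simp: b'_def\<close>)
  also have "\<dots> = image_mset (\<lambda>i. wedge3 (a i)) (image_mset \<pi> (mset_set {1..r}))"
    by (simp add: multiset.map_comp comp_def)
  also have "image_mset \<pi> (mset_set {1..r}) = mset_set {1..r}"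
    using bij by (simp add: image_mset_mset_set bij_betw_def)
  finally show ?thesis using \<open>s = r\<close> by simp
qed

theorem theorem5p2:
  fixes T :: "'a::field ^ 'n ^ 'n ^ 'n"
    and a :: "nat \<Rightarrow> nat \<Rightarrow> 'a ^ 'n"
    and U :: "nat \<Rightarrow> ('a ^ 'n) set"
    and r k :: nat
  assumes "CHAR('a) = 0 \<or> CHAR('a) \<ge> 5"
    and "r \<ge> 1"
    and "T = (\<Sum>i = 1..r. wedge3 (a i))"
    and "\<And>i. i \<in> {1..r} \<Longrightarrow> wedge3 (a i) \<noteq> 0"
    and "\<And>i. i \<in> {1..r} \<Longrightarrow> U i = vec.span {a i 1, a i 2, a i 3}"
    and "k = kruskal_rank r U"
    and "2 * int r \<le> 3 * int k - 2"
  shows "skew_rank T = r \<and> skew_rank_decomposition T r a \<and> unique_skew_rank_decomposition T"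
proof -
  have a: "skew_expression T r a" using assms(3) by (simp add: skew_expression_def)
  have k: "2 * r + 2 \<le> 3 * kruskal_rank r U" using assms(6,7) by simp
  note unique = skew_expression_unique[OF assms(2) a _ _ assms(4,5) k]
  have "skew_rank T \<le> r"
    unfolding skew_rank_def using a by (intro Least_le) blast
  moreover have "\<exists>b. skew_expression T (skew_rank T) b"
    using LeastI_ex[of "\<lambda>r. \<exists>a. skew_expression T r a"] a unfolding skew_rank_def by blast
  \<comment> \<open>A minimal expression has at most \<open>r\<close> terms, so
    \<open>unique\<close> applies to it. Afterwards every skew rank decomposition has
    \<open>r\<close> terms and is compared with \<open>a\<close>.\<close>
  ultimately have "skew_rank T = r" using unique by blast
  then show ?thesis
    using a unique unfolding skew_rank_decomposition_def unique_skew_rank_decomposition_def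
    by (metis order_refl)
qed

end
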